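(* Let $n$ be a positive integer and let $d_1>d_2>\cdots>d_k$ be all the positive divisors of $n$ (so $d_1=n$, $d_k=1$). For $1\leqslant i\leqslant k$ let $n_i$ be the degree in $\mathcal{P}(\mathbb{Z}_n)$ of an element of order $d_i$ (all elements of $\mathbb{Z}_n$ of the same order have the same degree), and set $m_i=n_i+1$. For $2\leqslant i\leqslant k-1$ set $\lambda_i=m_i/\phi(d_i)$, and let $\Phi=\prod_{i=2}^{k-1}\lambda_i$. Then $$\kappa(\mathbb{Z}_n)=\frac{1}{\Phi\, n^2}\prod_{i=1}^{k}m_i^{\phi(d_i)}\Big(\Phi+\sum_{\Lambda}\det\mathbf{A}(\Lambda)\,\lambda_2^{t_2}\lambda_3^{t_3}\cdots\lambda_{k-1}^{t_{k-1}}\Big),$$ where the sum is over all induced subgraphs $\Lambda$ (with nonempty vertex set) of $\overline{D}(n)\setminus\{d_1,d_k\}$, and for each such $\Lambda$ the exponents $t_i\in\{0,1\}$ ($2\leqslant i\leqslant k-1$) are defined by $t_i=0$ if $d_i$ is a vertex of $\Lambda$ and $t_i=1$ otherwise.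
   Context: For a finite group $G$, the power graph $\mathcal{P}(G)$ is the simple undirected graph whose vertices are the elements of $G$, two distinct vertices $x,y$ being adjacent iff $\langle x\rangle\subseteq\langle y\rangle$ or $\langle y\rangle\subseteq\langle x\rangle$. $\kappa(G)$ denotes the number of spanning trees of $\mathcal{P}(G)$. $\phi$ is Euler's totient function. The divisor graph $D(n)$ has vertex set the set of all positive divisors of $n$, two distinct divisors $d,d'$ being adjacent iff $d\mid d'$ or $d'\mid d$; $\overline{D}(n)$ is its complement, and $\overline{D}(n)\setminus\{d_1,d_k\}$ is obtained from it by deleting the vertices $d_1=n$ and $d_k=1$. $\mathbf{A}(\Lambda)$ is the adjacency matrix of $\Lambda$. Empty products equal $1$ and empty sums equal $0$. *)

theory Defs
  imports
    "HOL-Algebra.Generated_Groups"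
    "HOL-Algebra.Multiplicative_Group"
    "HOL-Algebra.Elementary_Groups"
    "HOL-Number_Theory.Totient"
    "Jordan_Normal_Form.Determinant"
begin

section \<open>Simple undirected graphs\<close>

text \<open>
  Edges are two-element sets of vertices. The spanning trees of the AFP entry Graph_Theory are
  sub-digraphs without directed cycles, so for a symmetric digraph they do not correspond to the
  spanning trees of the underlying undirected graph; hence the separate development here.
\<close>

record 'a ugraph =
  gverts :: "'a set"
  gedges :: "'a set set"

definition simple_graph :: "'a ugraph \<Rightarrow> bool" where
  "simple_graph G \<longleftrightarrow> (\<forall>e\<in>gedges G. e \<subseteq> gverts G \<and> card e = 2)"

definition graph_of :: "'a set \<Rightarrow> ('a \<Rightarrow> 'a \<Rightarrow> bool) \<Rightarrow> 'a ugraph" where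
  "graph_of V R = \<lparr>gverts = V, gedges = {{x, y} | x y. x \<in> V \<and> y \<in> V \<and> x \<noteq> y \<and> R x y}\<rparr>"

definition adjacent :: "'a ugraph \<Rightarrow> 'a \<Rightarrow> 'a \<Rightarrow> bool" where
  "adjacent G x y \<longleftrightarrow> {x, y} \<in> gedges G"

definition degree_in :: "'a ugraph \<Rightarrow> 'a \<Rightarrow> nat" where
  "degree_in G x = card {y \<in> gverts G. adjacent G x y}"

definition complement_graph :: "'a ugraph \<Rightarrow> 'a ugraph" where
  "complement_graph G = graph_of (gverts G) (\<lambda>x y. \<not> adjacent G x y)"

definition delete_vertices :: "'a ugraph \<Rightarrow> 'a set \<Rightarrow> 'a ugraph" where
  "delete_vertices G S = \<lparr>gverts = gverts G - S, gedges = {e \<in> gedges G. e \<inter> S = {}}\<rparr>"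

definition is_subgraph :: "'a ugraph \<Rightarrow> 'a ugraph \<Rightarrow> bool" where
  "is_subgraph H G \<longleftrightarrow> simple_graph H \<and> gverts H \<subseteq> gverts G \<and> gedges H \<subseteq> gedges G"

definition is_induced_subgraph :: "'a ugraph \<Rightarrow> 'a ugraph \<Rightarrow> bool" where
  "is_induced_subgraph H G \<longleftrightarrow>
     is_subgraph H G \<and> gedges H = {e \<in> gedges G. e \<subseteq> gverts H}"

definition connected_graph :: "'a ugraph \<Rightarrow> bool" where
  "connected_graph G \<longleftrightarrow>
     gverts G \<noteq> {} \<and> (\<forall>x\<in>gverts G. \<forall>y\<in>gverts G. (adjacent G)\<^sup>*\<^sup>* x y)"

definition is_cycle :: "'a ugraph \<Rightarrow> 'a list \<Rightarrow> bool" where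
  "is_cycle G vs \<longleftrightarrow>
     length vs \<ge> 3 \<and> distinct vs \<and> set vs \<subseteq> gverts G \<and>
     (\<forall>i < length vs. adjacent G (vs ! i) (vs ! (Suc i mod length vs)))"

definition is_tree :: "'a ugraph \<Rightarrow> bool" where
  "is_tree G \<longleftrightarrow> simple_graph G \<and> connected_graph G \<and> (\<nexists>vs. is_cycle G vs)"

definition spanning_trees :: "'a ugraph \<Rightarrow> 'a ugraph set" where
  "spanning_trees G = {T. is_subgraph T G \<and> gverts T = gverts G \<and> is_tree T}"

text \<open>
  The rows and columns follow the increasing order of the vertices; the determinant does not depend
  on which order is chosen.
\<close>

definition adjacency_matrix :: "'a::linorder ugraph \<Rightarrow> real mat" where
  "adjacency_matrix G =
     (let vs = sorted_list_of_set (gverts G)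
      in mat (length vs) (length vs) (\<lambda>(i, j). if adjacent G (vs ! i) (vs ! j) then 1 else 0))"

section \<open>Power graphs and divisor graphs\<close>

definition power_graph :: "('a, 'b) monoid_scheme \<Rightarrow> 'a ugraph" where
  "power_graph G = graph_of (carrier G)
     (\<lambda>x y. generate G {x} \<subseteq> generate G {y} \<or> generate G {y} \<subseteq> generate G {x})"

definition kappa :: "('a, 'b) monoid_scheme \<Rightarrow> nat" where
  "kappa G = card (spanning_trees (power_graph G))"

definition divisor_graph :: "nat \<Rightarrow> nat ugraph" where
  "divisor_graph n = graph_of {d. d dvd n} (\<lambda>d d'. d dvd d' \<or> d' dvd d)"

end

theory Submission
  imports Defs "HOL-Library.Transitive_Closure_Table"
begin

text \<open>
  Let \<open>L\<close> be the Laplacian of the power graph of \<open>\<int>/n\<close> and \<open>J\<close> the all-ones matrix. The number of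
  spanning trees is \<open>det (L + J) / n\<^sup>2\<close>. The diagonal entry of \<open>L + J\<close> at \<open>x\<close> is the degree of \<open>x\<close> plus
  one, and off the diagonal there is a 1 exactly at the non-adjacent pairs. In a finite cyclic group
  \<open>\<langle>x\<rangle> \<subseteq> \<langle>y\<rangle>\<close> holds iff the order of \<open>x\<close> divides the order of \<open>y\<close>, so every entry depends
  only on the two orders and on whether \<open>x = y\<close>: with \<open>o x\<close> the order of \<open>x\<close>, \<open>m\<close> the degree plus one
  and \<open>B\<close> the adjacency matrix of the complement of the divisor graph, the entry is
  \<open>B (o x) (o y)\<close>, plus \<open>m (o x)\<close> on the diagonal.

  Expanding such a determinant along its diagonal part gives one principal minor of
  \<open>(x, y) \<mapsto> B (o x) (o y)\<close> for each set \<open>T\<close> of group elements (\<open>set_det_add_diagonal\<close>). Two elements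
  of the same order give equal rows, so only sets \<open>T\<close> with pairwise distinct orders matter; such a
  minor is the minor of \<open>B\<close> on the set \<open>S\<close> of these orders, and \<open>S\<close> arises from
  \<open>\<Prod>d\<in>S. \<phi>(d)\<close> sets \<open>T\<close> (\<open>set_det_blocks\<close>). The divisors \<open>1\<close> and \<open>n\<close> are comparable to all divisors
  and give zero rows of \<open>B\<close>, so \<open>S\<close> ranges over sets of proper divisors other than 1, that is, over the
  vertex sets of the induced subgraphs in question. Factoring out all \<open>m\<close> and then
  \<open>1 / \<Phi>\<close> yields the formula; the term \<open>\<Phi>\<close> is the contribution of the empty \<open>S\<close>.

  The matrix-tree theorem is proved without the Cauchy-Binet formula. The row of a vertex \<open>x\<close> in the
  Laplacian is the sum of the rows \<open>e\<^sub>x - e\<^sub>z\<close> over the neighbours \<open>z\<close> of \<open>x\<close>. Multilinearity therefore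
  writes the minor at a root \<open>r\<close> as a sum over all functions that choose a neighbour \<open>f x\<close> for every
  \<open>x \<noteq> r\<close>. The determinant belonging to \<open>f\<close> is 1 if iterating \<open>f\<close> leads from everywhere to \<open>r\<close>, and 0
  otherwise; functions of the first kind are the parent maps of the spanning trees rooted at \<open>r\<close>.

  Since subsets of vertices and of divisors occur throughout, determinants are taken of functions on
  arbitrary finite index sets rather than of matrices with rows numbered from 0.
\<close>

section \<open>Determinants over finite index sets\<close>

definition set_det :: "'a set \<Rightarrow> ('a \<Rightarrow> 'a \<Rightarrow> 'b) \<Rightarrow> 'b::comm_ring_1" where
  "set_det S A = (\<Sum>p | p permutes S. of_int (sign p) * (\<Prod>i\<in>S. A i (p i)))"

lemma set_det_cong:
  assumes "S = T" and "\<And>i j. i \<in> T \<Longrightarrow> j \<in> T \<Longrightarrow> A i j = B i j"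
  shows "set_det S A = set_det T B"
  unfolding set_det_def \<open>S = T\<close>
  by (intro sum.cong refl arg_cong2[where f = "(*)"] prod.cong)
     (auto intro!: assms(2) simp: permutes_in_image)

text \<open>
  Conjugation by \<open>f\<close> is a sign-preserving bijection between the permutations of \<open>S\<close> and of \<open>T\<close>.
\<close>

lemma set_det_reindex:
  assumes "finite S" and f: "bij_betw f S T"
  shows "set_det T A = set_det S (\<lambda>i j. A (f i) (f j))"
proof -
  have inj: "inj_on f S" and T: "T = f ` S"
    using f by (auto simp: bij_betw_def)
  have left_inv: "inv_into S f (f x) = x" if "x \<in> S" for x
    using inj that by simp
  have g: "bij_betw (inv_into S f) T S"
    using f by (rule bij_betw_inv_into)
  have right_inv: "f (inv_into S f y) = y" if "y \<in> T" for y
    using that by (simp add: T f_inv_into_f)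
  have "set_det S (\<lambda>i j. A (f i) (f j)) =
      (\<Sum>q | q permutes T. of_int (sign q) * (\<Prod>i\<in>T. A i (q i)))"
    unfolding set_det_def
  proof (rule sum.reindex_bij_witness[where j = "map_permutation S f"
        and i = "map_permutation T (inv_into S f)"], goal_cases)
    case (1 p)
    then show ?case
      using map_permutation_compose_inv[OF f, of p "inv_into S f"] left_inv by simp
  next
    case (2 p)
    then show ?case using map_permutation_permutes[OF f] by simp
  next
    case (3 q)
    then show ?case using map_permutation_compose_inv[OF g, of q f] right_inv by simp
  next
    case (4 q)
    then show ?case using map_permutation_permutes[OF g] by simp
  next
    case (5 p)
    then have p: "p permutes S" by simp
    have "(\<Prod>i\<in>T. A i (map_permutation S f p i)) = (\<Prod>i\<in>S. A (f i) (f (p i)))"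
      unfolding T by (simp add: prod.reindex[OF inj] map_permutation_apply[OF inj])
    then show ?case
      using sign_map_permutation[OF inj p \<open>finite S\<close>] by simp
  qed
  then show ?thesis by (simp add: set_det_def)
qed

text \<open>
  The bridge to determinants of matrices. It gives access to the kernel criterion and to the rule for
  identical rows, and evaluates the determinant of an adjacency matrix.
\<close>

lemma set_det_eq_det:
  assumes "distinct vs"
  shows "set_det (set vs) A = det (mat (length vs) (length vs) (\<lambda>(i, j). A (vs ! i) (vs ! j)))"
proof -
  have "set_det (set vs) A = set_det {0..<length vs} (\<lambda>i j. A (vs ! i) (vs ! j))"
    using bij_betw_nth[OF assms, of "{..<length vs}" "set vs"]
    by (intro set_det_reindex) (auto simp: lessThan_atLeast0)
  also have "\<dots> = det (mat (length vs) (length vs) (\<lambda>(i, j). A (vs ! i) (vs ! j)))"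
    unfolding set_det_def
    by (subst det_def'[of _ "length vs"])
       (auto intro!: sum.cong prod.cong simp: permutes_in_image[where S = "{0..<length vs}", simplified])
  finally show ?thesis .
qed

lemma set_det_eq_0_if_kernel:
  fixes A :: "'a \<Rightarrow> 'a \<Rightarrow> 'b::idom"
  assumes "finite S" and ker: "\<And>i. i \<in> S \<Longrightarrow> (\<Sum>j\<in>S. A i j * v j) = 0"
    and x: "x \<in> S" "v x \<noteq> 0"
  shows "set_det S A = 0"
proof -
  obtain vs where vs: "set vs = S" "distinct vs"
    using finite_distinct_list[OF \<open>finite S\<close>] by blast
  define n where "n = length vs"
  define M where "M = mat n n (\<lambda>(i, j). A (vs ! i) (vs ! j))"
  define w where "w = Matrix.vec n (\<lambda>i. v (vs ! i))"
  have sum_nth: "(\<Sum>j = 0..<n. f (vs ! j)) = (\<Sum>y\<in>S. f y)" for f :: "'a \<Rightarrow> 'b"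
    using sum.reindex_bij_betw[OF bij_betw_nth[OF vs(2) refl refl], of f] vs(1)
    by (simp add: n_def atLeast0LessThan)
  have "w \<in> carrier_vec n" and M: "M \<in> carrier_mat n n"
    by (auto simp: w_def M_def)
  moreover have "w \<noteq> 0\<^sub>v n"
  proof
    assume "w = 0\<^sub>v n"
    obtain i where i: "i < n" "vs ! i = x"
      using x(1) vs(1) by (metis in_set_conv_nth n_def)
    then have "w $ i = v x" by (simp add: w_def)
    with \<open>w = 0\<^sub>v n\<close> i x(2) show False by simp
  qed
  moreover have "M *\<^sub>v w = 0\<^sub>v n"
  proof (rule eq_vecI)
    fix i assume "i < dim_vec (0\<^sub>v n :: 'b Matrix.vec)"
    then have i: "i < n" by simp
    then have "(M *\<^sub>v w) $ i = (\<Sum>j = 0..<n. A (vs ! i) (vs ! j) * v (vs ! j))"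
      by (simp add: M_def w_def scalar_prod_def)
    also have "\<dots> = 0"
      using sum_nth[of "\<lambda>y. A (vs ! i) y * v y"] ker[of "vs ! i"] i vs(1)
        nth_mem[of i vs]
      by (simp add: n_def)
    finally show "(M *\<^sub>v w) $ i = 0\<^sub>v n $ i" using i by simp
  qed (simp add: M_def)
  ultimately have "det M = 0"
    using det_0_iff_vec_prod_zero[OF M] by blast
  then show ?thesis
    using set_det_eq_det[OF vs(2), of A] vs(1) by (simp add: M_def n_def)
qed

lemma set_det_identical_rows:
  assumes "finite S" and xy: "x \<in> S" "y \<in> S" "x \<noteq> y"
    and row: "\<And>j. j \<in> S \<Longrightarrow> A x j = A y j"
  shows "set_det S A = 0"
proof -
  obtain vs where vs: "set vs = S" "distinct vs"
    using finite_distinct_list[OF \<open>finite S\<close>] by blast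
  obtain i j where ij: "i < length vs" "j < length vs" "vs ! i = x" "vs ! j = y"
    using xy vs(1) by (metis in_set_conv_nth)
  let ?M = "mat (length vs) (length vs) (\<lambda>(i, j). A (vs ! i) (vs ! j))"
  have "det ?M = 0"
  proof (rule det_identical_rows)
    show "i \<noteq> j" using ij xy(3) by auto
    show "row ?M i = row ?M j"
      using ij row vs(1) by (intro eq_vecI) auto
  qed (use ij in auto)
  then show ?thesis using set_det_eq_det[OF vs(2), of A] vs(1) by simp
qed

lemma set_det_eq_0_if_zero_row:
  assumes "finite S" and "x \<in> S" and "\<And>j. j \<in> S \<Longrightarrow> A x j = 0"
  shows "set_det S A = 0"
  unfolding set_det_def
proof (rule sum.neutral, intro ballI)
  fix p assume "p \<in> {p. p permutes S}"
  then have "A x (p x) = 0"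
    using assms(2,3) permutes_in_image by fastforce
  then have "(\<Prod>i\<in>S. A i (p i)) = 0"
    using assms(1,2) by (meson prod_zero)
  then show "of_int (sign p) * (\<Prod>i\<in>S. A i (p i)) = 0" by simp
qed

text \<open>
  Multilinearity in all rows at once: if every row is a sum, the determinant is the sum over all ways
  to choose one summand from each row.
\<close>

lemma set_det_sum_rows:
  assumes "finite S" and K: "\<And>i. i \<in> S \<Longrightarrow> finite (K i)"
  shows "set_det S (\<lambda>i j. \<Sum>k\<in>K i. c i k j) = (\<Sum>f\<in>PiE S K. set_det S (\<lambda>i. c i (f i)))"
proof -
  have "set_det S (\<lambda>i j. \<Sum>k\<in>K i. c i k j) =
      (\<Sum>p | p permutes S. \<Sum>f\<in>PiE S K. of_int (sign p) * (\<Prod>i\<in>S. c i (f i) (p i)))"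
    unfolding set_det_def by (simp add: prod_sum_PiE[OF assms] sum_distrib_left)
  then show ?thesis by (simp add: set_det_def sum.swap[of _ "PiE S K"])
qed

lemma set_det_add:
  assumes "finite S"
  shows "set_det S (\<lambda>i j. A i j + B i j) =
    (\<Sum>T\<in>Pow S. set_det S (\<lambda>i. if i \<in> T then A i else B i))"
proof -
  have "(\<Prod>i\<in>T. A i (p i)) * (\<Prod>i\<in>S - T. B i (p i)) =
      (\<Prod>i\<in>S. (if i \<in> T then A i else B i) (p i))" if "T \<in> Pow S" for T p
  proof -
    have "(\<Prod>i\<in>S. (if i \<in> T then A i else B i) (p i)) =
      (\<Prod>i\<in>S - T. (if i \<in> T then A i else B i) (p i)) *
      (\<Prod>i\<in>T. (if i \<in> T then A i else B i) (p i))"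
      using that assms by (intro prod.subset_diff) auto
    then show ?thesis by (simp add: mult.commute)
  qed
  then have "set_det S (\<lambda>i j. A i j + B i j) =
      (\<Sum>p | p permutes S. \<Sum>T\<in>Pow S.
        of_int (sign p) * (\<Prod>i\<in>S. (if i \<in> T then A i else B i) (p i)))"
    unfolding set_det_def by (simp add: prod_add[OF assms] sum_distrib_left)
  then show ?thesis by (simp add: set_det_def sum.swap[of _ "Pow S"])
qed

lemma set_det_row_linear:
  assumes "finite S" and "r \<in> S"
  shows "set_det S (\<lambda>i. if i = r then (\<lambda>j. a j + c * b j) else A i) =
    set_det S (\<lambda>i. if i = r then a else A i) + c * set_det S (\<lambda>i. if i = r then b else A i)"
proof -
  have split: "(\<Prod>i\<in>S. (if i = r then u else A i) (p i)) = u (p r) * (\<Prod>i\<in>S - {r}. A i (p i))"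
    for u p
    by (subst prod.remove[OF assms]) (auto intro!: arg_cong2[where f = "(*)"] prod.cong)
  show ?thesis
    unfolding set_det_def split
    unfolding sum_distrib_left sum.distrib[symmetric]
    by (intro sum.cong refl) (simp add: algebra_simps)
qed

text \<open>
  A permutation that moves a point outside \<open>T\<close> meets a zero entry, so only the permutations of \<open>T\<close>
  contribute.
\<close>

lemma set_det_diagonal_rows:
  assumes "finite S" and "T \<subseteq> S"
  shows "set_det S (\<lambda>i. if i \<in> T then A i else (\<lambda>j. if i = j then x i else 0)) =
    set_det T A * (\<Prod>i\<in>S - T. x i)"
proof -
  let ?M = "\<lambda>i. if i \<in> T then A i else (\<lambda>j. if i = j then x i else 0)"
  have split: "(\<Prod>i\<in>S. ?M i (p i)) = (\<Prod>i\<in>S - T. if i = p i then x i else 0) * (\<Prod>i\<in>T. A i (p i))"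
    for p
    by (subst prod.subset_diff[OF assms(2,1)]) simp
  have "set_det S ?M = (\<Sum>p | p permutes T. of_int (sign p) * (\<Prod>i\<in>S. ?M i (p i)))"
    unfolding set_det_def
  proof (rule sum.mono_neutral_right)
    show "finite {p. p permutes S}" using assms(1) by (rule finite_permutations)
    show "{p. p permutes T} \<subseteq> {p. p permutes S}" using permutes_subset assms(2) by auto
    show "\<forall>p\<in>{p. p permutes S} - {p. p permutes T}. of_int (sign p) * (\<Prod>i\<in>S. ?M i (p i)) = 0"
    proof
      fix p assume p: "p \<in> {p. p permutes S} - {p. p permutes T}"
      have "\<exists>i\<in>S - T. p i \<noteq> i"
      proof (rule ccontr)
        assume "\<not> (\<exists>i\<in>S - T. p i \<noteq> i)"
        then have "p x = x" if "x \<in> S - T" for x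
          using that by blast
        moreover have "p permutes S"
          using p by simp
        ultimately have "p permutes T"
          by (metis permutes_superset)
        with p show False by simp
      qed
      then obtain i where i: "i \<in> S - T" "p i \<noteq> i" by blast
      then have "(\<Prod>i\<in>S - T. if i = p i then x i else 0) = 0"
        using assms(1) by (intro prod_zero) (auto intro!: bexI[of _ i])
      then show "of_int (sign p) * (\<Prod>i\<in>S. ?M i (p i)) = 0"
        unfolding split by simp
    qed
  qed
  also have "\<dots> = (\<Sum>p | p permutes T. of_int (sign p) * (\<Prod>i\<in>T. A i (p i)) * (\<Prod>i\<in>S - T. x i))"
  proof (rule sum.cong[OF refl])
    fix p assume "p \<in> {p. p permutes T}"
    then have "(\<Prod>i\<in>S - T. if i = p i then x i else 0) = (\<Prod>i\<in>S - T. x i)"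
      by (intro prod.cong) (auto simp: permutes_not_in)
    then show "of_int (sign p) * (\<Prod>i\<in>S. ?M i (p i)) =
        of_int (sign p) * (\<Prod>i\<in>T. A i (p i)) * (\<Prod>i\<in>S - T. x i)"
      unfolding split by (simp add: mult_ac)
  qed
  also have "\<dots> = set_det T A * (\<Prod>i\<in>S - T. x i)"
    by (simp add: set_det_def sum_distrib_right)
  finally show ?thesis .
qed

text \<open>
  The expansion of \<open>det (A + diag x)\<close> by principal minors: each row comes either from \<open>A\<close> or from the
  diagonal matrix, and the rows of the second kind leave the minor on the remaining indices.
\<close>

lemma set_det_add_diagonal:
  assumes "finite S"
  shows "set_det S (\<lambda>i j. A i j + (if i = j then x i else 0)) =
    (\<Sum>T\<in>Pow S. set_det T A * (\<Prod>i\<in>S - T. x i))"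
  unfolding set_det_add[OF assms]
  by (intro sum.cong refl set_det_diagonal_rows assms) auto

section \<open>The matrix-tree theorem\<close>

definition nbrs :: "'a ugraph \<Rightarrow> 'a \<Rightarrow> 'a set" where
  "nbrs G x = {y \<in> gverts G. adjacent G x y}"

definition laplacian :: "'a ugraph \<Rightarrow> 'a \<Rightarrow> 'a \<Rightarrow> real" where
  "laplacian G x y =
    (if x = y then real (degree_in G x) else if adjacent G x y then - 1 else 0)"

text \<open>
  That iteration of \<open>f\<close> leads from every vertex to \<open>r\<close> is expressed by a rank function that decreases
  along \<open>f\<close>: the inductions below run over such a rank. The maps are extensional, so that each is
  determined by its values away from the root.
\<close>

definition rooted_maps :: "'a ugraph \<Rightarrow> 'a \<Rightarrow> ('a \<Rightarrow> 'a) set" where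
  "rooted_maps G r =
    {f \<in> PiE (gverts G - {r}) (nbrs G). \<exists>h :: 'a \<Rightarrow> nat. \<forall>x \<in> gverts G - {r}. h (f x) < h x}"

lemma adjacent_sym: "adjacent G x y \<longleftrightarrow> adjacent G y x"
  by (simp add: adjacent_def insert_commute)

lemma simple_graph_adjacentD:
  assumes "simple_graph G" and "adjacent G x y"
  shows "x \<in> gverts G" "y \<in> gverts G" "x \<noteq> y"
  using assms by (fastforce simp: simple_graph_def adjacent_def)+

text \<open>
  Only the identity contributes. A permutation with nonzero product sends each \<open>x\<close> to \<open>x\<close> or to \<open>f x\<close>;
  by induction on the rank it fixes every point, since \<open>f x\<close> has smaller rank, is already known to be
  fixed, and so cannot also be the image of \<open>x\<close>.
\<close>

lemma parent_map_det_rooted: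
  fixes h :: "'a \<Rightarrow> nat"
  assumes "finite S" and h: "\<And>x. x \<in> S \<Longrightarrow> h (f x) < h x"
  shows "set_det S (\<lambda>x y. of_bool (y = x) - of_bool (y = f x)) = (1::'b::comm_ring_1)"
proof -
  let ?M = "\<lambda>x y. of_bool (y = x) - of_bool (y = f x) :: 'b"
  have zero: "(\<Prod>x\<in>S. ?M x (p x)) = 0" if p: "p permutes S" "p \<noteq> id" for p
  proof (rule ccontr)
    assume "(\<Prod>x\<in>S. ?M x (p x)) \<noteq> 0"
    then have nz: "?M x (p x) \<noteq> 0" if "x \<in> S" for x
      using that assms(1) prod_zero by (metis (mono_tags, lifting))
    have step: "p x = x \<or> p x = f x" if "x \<in> S" for x
      using nz[OF that] by (auto split: if_splits)
    have fixed: "p x = x" if "x \<in> S" for x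
      using that
    proof (induction "h x" arbitrary: x rule: less_induct)
      case less
      show ?case
      proof (rule ccontr)
        assume "p x \<noteq> x"
        then have fx: "p x = f x" using step less.prems by blast
        then have "f x \<in> S" using permutes_in_image[OF p(1), of x] less.prems by simp
        then have "p (f x) = f x" using less.hyps h less.prems by blast
        then have "f x = x" using fx permutes_inj[OF p(1)] by (metis injD)
        with fx \<open>p x \<noteq> x\<close> show False by simp
      qed
    qed
    have "p = id"
      using fixed permutes_not_in[OF p(1)] by (metis eq_id_iff)
    with p(2) show False by simp
  qed
  have "set_det S ?M = (\<Sum>p\<in>{id}. of_int (sign p) * (\<Prod>x\<in>S. ?M x (p x)))"
    unfolding set_det_def
    using zero by (intro sum.mono_neutral_right)
      (auto simp: finite_permutations assms(1) permutes_id)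
  also have "\<dots> = (\<Prod>x\<in>S. 1)"
  proof -
    have "x \<noteq> f x" if "x \<in> S" for x using h[OF that] by auto
    then have "(\<Prod>x\<in>S. ?M x x) = (\<Prod>x\<in>S. 1)"
      by (intro prod.cong) auto
    then show ?thesis by simp
  qed
  finally show ?thesis by simp
qed

text \<open>
  The points that never reach \<open>r\<close> form a set \<open>U\<close> such that \<open>f x \<in> U\<close> iff \<open>x \<in> U\<close>. Its indicator is
  therefore in the kernel of the matrix. If \<open>U\<close> were empty, the number of steps to \<open>r\<close> would be a rank
  function.
\<close>

lemma parent_map_det_not_rooted:
  fixes f :: "'a \<Rightarrow> 'a"
  assumes "finite S" and "r \<notin> S" and f: "\<And>x. x \<in> S \<Longrightarrow> f x \<in> insert r S"
    and not_rooted: "\<nexists>h :: 'a \<Rightarrow> nat. \<forall>x\<in>S. h (f x) < h x"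
  shows "set_det S (\<lambda>x y. of_bool (y = x) - of_bool (y = f x)) = (0::'b::idom)"
proof -
  define U where "U = {x \<in> S. \<forall>n. (f ^^ n) x \<noteq> r}"
  have "U \<noteq> {}"
  proof
    assume "U = {}"
    then have ex: "\<exists>n. (f ^^ n) x = r" if "x \<in> S" for x using that by (auto simp: U_def)
    define h where "h x = (LEAST n. (f ^^ n) x = r)" for x
    have "h (f x) < h x" if x: "x \<in> S" for x
    proof -
      have *: "(f ^^ h x) x = r" unfolding h_def using ex[OF x] by (rule LeastI_ex)
      then obtain m where m: "h x = Suc m" using x \<open>r \<notin> S\<close> by (cases "h x") auto
      then have "(f ^^ m) (f x) = r" using * by (simp add: funpow_swap1)
      then have "h (f x) \<le> m" unfolding h_def by (rule Least_le)
      then show ?thesis using m by simp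
    qed
    then show False using not_rooted by blast
  qed
  then obtain x0 where x0: "x0 \<in> U" by blast
  have iter: "(f ^^ Suc n) x = (f ^^ n) (f x)" for n x by (simp add: funpow_swap1)
  have closed: "f x \<in> U \<longleftrightarrow> x \<in> U" if "x \<in> S" for x
  proof
    assume x: "x \<in> U"
    then have *: "(f ^^ n) x \<noteq> r" for n by (simp add: U_def)
    have "f x \<noteq> r" using *[of 1] by simp
    then show "f x \<in> U" using f[OF that] * iter by (auto simp: U_def simp del: funpow.simps)
  next
    assume fx: "f x \<in> U"
    show "x \<in> U"
    proof -
      have "(f ^^ n) x \<noteq> r" for n
      proof (cases n)
        case 0
        then show ?thesis using that \<open>r \<notin> S\<close> by auto
      next
        case (Suc m)
        then show ?thesis using fx iter[of m x] by (simp add: U_def)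
      qed
      then show ?thesis using that by (simp add: U_def)
    qed
  qed
  show ?thesis
  proof (rule set_det_eq_0_if_kernel[where v = "\<lambda>x. of_bool (x \<in> U)" and x = x0])
    fix x assume x: "x \<in> S"
    have "(\<Sum>y\<in>S. of_bool (y = z) * of_bool (y \<in> U)) = (of_bool (z \<in> U) :: 'b)" for z
    proof -
      have "(\<Sum>y\<in>S. of_bool (y = z) * of_bool (y \<in> U)) =
          (\<Sum>y\<in>S. if y = z then of_bool (z \<in> U) else (0 :: 'b))"
        by (intro sum.cong) auto
      then show ?thesis using \<open>finite S\<close> by (auto simp: U_def)
    qed
    then show "(\<Sum>y\<in>S. (of_bool (y = x) - of_bool (y = f x)) * of_bool (y \<in> U)) = (0 :: 'b)"
      using closed[OF x] by (simp add: left_diff_distrib sum_subtractf)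
  qed (use x0 \<open>finite S\<close> in \<open>auto simp: U_def\<close>)
qed

text \<open>
  Away from the root, the row of \<open>x\<close> in the Laplacian is the sum over the neighbours \<open>z\<close> of \<open>x\<close> of the row
  with 1 at \<open>x\<close> and -1 at \<open>z\<close>. A choice of one neighbour for each \<open>x\<close> yields 1 or 0 according to whether
  it is rooted.
\<close>

lemma set_det_laplacian_minor:
  assumes "finite (gverts G)" and "simple_graph G"
  shows "set_det (gverts G - {r}) (laplacian G) = real (card (rooted_maps G r))"
proof -
  let ?S = "gverts G - {r}"
  let ?M = "\<lambda>f x y. of_bool (y = x) - of_bool (y = f x) :: real"
  have fin: "finite ?S" "finite (nbrs G x)" for x
    using assms(1) by (auto simp: nbrs_def)
  have "set_det ?S (laplacian G) =
      set_det ?S (\<lambda>x y. \<Sum>z\<in>nbrs G x. of_bool (y = x) - of_bool (y = z))"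
  proof (rule set_det_cong[OF refl])
    fix x y assume xy: "x \<in> ?S" "y \<in> ?S"
    have "(\<Sum>z\<in>nbrs G x. of_bool (y = z)) = (of_bool (y \<in> nbrs G x) :: real)"
      using fin(2) by (simp add: of_bool_def)
    moreover have "y \<in> nbrs G x \<longleftrightarrow> adjacent G x y"
      using xy by (simp add: nbrs_def)
    moreover have "\<not> adjacent G x x"
      using simple_graph_adjacentD(3)[OF assms(2), of x x] by blast
    ultimately show "laplacian G x y = (\<Sum>z\<in>nbrs G x. of_bool (y = x) - of_bool (y = z))"
      by (auto simp: laplacian_def sum_subtractf degree_in_def nbrs_def[symmetric])
  qed
  also have "\<dots> = (\<Sum>f\<in>PiE ?S (nbrs G). set_det ?S (?M f))"
    by (rule set_det_sum_rows[OF fin])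
  also have "\<dots> = (\<Sum>f\<in>PiE ?S (nbrs G). of_bool (f \<in> rooted_maps G r))"
  proof (rule sum.cong[OF refl])
    fix f assume f: "f \<in> PiE ?S (nbrs G)"
    show "set_det ?S (?M f) = of_bool (f \<in> rooted_maps G r)"
    proof (cases "f \<in> rooted_maps G r")
      case True
      then obtain h :: "'a \<Rightarrow> nat" where "\<forall>x\<in>?S. h (f x) < h x"
        by (auto simp: rooted_maps_def)
      then show ?thesis using parent_map_det_rooted[OF fin(1), of h f] True by simp
    next
      case False
      then have "\<nexists>h :: 'a \<Rightarrow> nat. \<forall>x\<in>?S. h (f x) < h x"
        using f by (auto simp: rooted_maps_def)
      moreover have "f x \<in> insert r ?S" if "x \<in> ?S" for x
        using PiE_mem[OF f that] by (auto simp: nbrs_def)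
      ultimately show ?thesis
        using parent_map_det_not_rooted[OF fin(1), of r f] False by simp
    qed
  qed
  also have "\<dots> = real (card (PiE ?S (nbrs G) \<inter> rooted_maps G r))"
    using finite_PiE[of ?S "nbrs G"] fin by (simp add: of_bool_def sum.If_cases Collect_conj_eq)
  also have "PiE ?S (nbrs G) \<inter> rooted_maps G r = rooted_maps G r"
    by (auto simp: rooted_maps_def)
  finally show ?thesis .
qed

definition parent_tree :: "'a set \<Rightarrow> 'a \<Rightarrow> ('a \<Rightarrow> 'a) \<Rightarrow> 'a ugraph" where
  "parent_tree V r f = \<lparr>gverts = V, gedges = (\<lambda>x. {x, f x}) ` (V - {r})\<rparr>"

lemma adjacent_parent_tree:
  "adjacent (parent_tree V r f) x y \<longleftrightarrow>
     x \<in> V - {r} \<and> y = f x \<or> y \<in> V - {r} \<and> x = f y"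
  by (auto simp: adjacent_def parent_tree_def image_iff doubleton_eq_iff)

lemma parent_tree_connected_to_root:
  fixes h :: "'a \<Rightarrow> nat"
  assumes f: "\<And>x. x \<in> V - {r} \<Longrightarrow> f x \<in> V" and h: "\<And>x. x \<in> V - {r} \<Longrightarrow> h (f x) < h x"
    and "x \<in> V"
  shows "(adjacent (parent_tree V r f))\<^sup>*\<^sup>* x r"
  using \<open>x \<in> V\<close>
proof (induction "h x" arbitrary: x rule: less_induct)
  case less
  show ?case
  proof (cases "x = r")
    case False
    then have x: "x \<in> V - {r}" using less.prems by simp
    have "(adjacent (parent_tree V r f))\<^sup>*\<^sup>* (f x) r"
      using less.hyps[OF h[OF x] f[OF x]] .
    moreover have "adjacent (parent_tree V r f) x (f x)"
      using x by (simp add: adjacent_parent_tree)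
    ultimately show ?thesis by (rule converse_rtranclp_into_rtranclp[rotated])
  qed simp
qed

lemma rtranclp_adjacent_sym: "(adjacent G)\<^sup>*\<^sup>* x y \<Longrightarrow> (adjacent G)\<^sup>*\<^sup>* y x"
  using symp_rtranclp[of "adjacent G"] by (auto simp: symp_def adjacent_sym)

lemma parent_tree_connected:
  fixes h :: "'a \<Rightarrow> nat"
  assumes f: "\<And>x. x \<in> V - {r} \<Longrightarrow> f x \<in> V" and h: "\<And>x. x \<in> V - {r} \<Longrightarrow> h (f x) < h x"
    and "r \<in> V"
  shows "connected_graph (parent_tree V r f)"
proof -
  have "(adjacent (parent_tree V r f))\<^sup>*\<^sup>* x y" if "x \<in> V" "y \<in> V" for x y
    using parent_tree_connected_to_root[of V r f h, OF f h] that
    by (meson rtranclp_adjacent_sym rtranclp_trans)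
  then show ?thesis
    using \<open>r \<in> V\<close> by (auto simp: connected_graph_def parent_tree_def)
qed

text \<open>
  A vertex of maximal rank on a cycle would have its parent as both of its neighbours on the cycle.
\<close>

lemma parent_tree_acyclic:
  fixes h :: "'a \<Rightarrow> nat"
  assumes h: "\<And>x. x \<in> V - {r} \<Longrightarrow> h (f x) < h x"
  shows "\<not> is_cycle (parent_tree V r f) vs"
proof
  let ?T = "parent_tree V r f"
  assume cyc: "is_cycle ?T vs"
  define n where "n = length vs"
  have n: "n \<ge> 3" and dist: "distinct vs"
    and adj: "\<And>i. i < n \<Longrightarrow> adjacent ?T (vs ! i) (vs ! (Suc i mod n))"
    using cyc by (auto simp: is_cycle_def n_def)
  have "finite ((\<lambda>i. h (vs ! i)) ` {..<n})" "(\<lambda>i. h (vs ! i)) ` {..<n} \<noteq> {}"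
    using n by (auto simp: lessThan_empty_iff)
  then obtain i where i: "i < n" and top: "\<And>j. j < n \<Longrightarrow> h (vs ! j) \<le> h (vs ! i)"
    using Max_in[of "(\<lambda>i. h (vs ! i)) ` {..<n}"] Max_ge[of "(\<lambda>i. h (vs ! i)) ` {..<n}"]
    by (smt (verit) imageE image_eqI lessThan_iff)
  have parent: "vs ! j = f (vs ! i)" if "j < n" "adjacent ?T (vs ! i) (vs ! j)" for j
    using that(2) top[OF that(1)] h[of "vs ! j"] by (auto simp: adjacent_parent_tree)
  \<comment> \<open>\<open>a\<close> and \<open>b\<close> are the positions after and before \<open>i\<close> on the cycle; \<open>n \<ge> 3\<close> keeps them apart.\<close>
  define a where "a = Suc i mod n"
  define b where "b = (if i = 0 then n - 1 else i - 1)"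
  have ab: "a < n" "b < n" "Suc b mod n = i" "a \<noteq> b"
    using n i by (auto simp: a_def b_def mod_Suc)
  have "adjacent ?T (vs ! i) (vs ! a)"
    using adj[OF i] by (simp add: a_def)
  moreover have "adjacent ?T (vs ! i) (vs ! b)"
    using adj[OF ab(2)] ab(3) by (simp add: adjacent_sym)
  ultimately have "vs ! a = vs ! b"
    using parent ab by metis
  then show False
    using dist ab by (simp add: nth_eq_iff_index_eq n_def)
qed

lemma parent_tree_spanning:
  assumes "simple_graph G" and "r \<in> gverts G" and "f \<in> rooted_maps G r"
  shows "parent_tree (gverts G) r f \<in> spanning_trees G"
proof -
  let ?V = "gverts G"
  obtain h :: "'a \<Rightarrow> nat" where h: "\<And>x. x \<in> ?V - {r} \<Longrightarrow> h (f x) < h x"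
    and f: "\<And>x. x \<in> ?V - {r} \<Longrightarrow> f x \<in> nbrs G x"
    using assms(3) by (auto simp: rooted_maps_def PiE_iff)
  have sub: "is_subgraph (parent_tree ?V r f) G"
  proof -
    have e: "{x, f x} \<in> gedges G" "f x \<in> ?V" "x \<noteq> f x" if "x \<in> ?V - {r}" for x
      using f[OF that] simple_graph_adjacentD[OF assms(1)] by (auto simp: nbrs_def adjacent_def)
    then show ?thesis
      by (auto simp: is_subgraph_def simple_graph_def parent_tree_def)
  qed
  moreover have "is_tree (parent_tree ?V r f)"
    unfolding is_tree_def
    using sub parent_tree_acyclic[of ?V r h f, OF h]
      parent_tree_connected[of ?V r f h, OF _ h assms(2)] f
    by (auto simp: is_subgraph_def nbrs_def)
  ultimately show ?thesis by (simp add: spanning_trees_def parent_tree_def)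
qed

text \<open>
  By induction on the rank for \<open>f\<close>. If \<open>f x \<noteq> g x\<close>, the edge from \<open>x\<close> to \<open>f x\<close> must point the other
  way for \<open>g\<close>, so \<open>g (f x) = x\<close>. But \<open>f\<close> and \<open>g\<close> agree at \<open>f x\<close>, which gives \<open>f (f x) = x\<close>,
  contradicting that ranks decrease.
\<close>

lemma parent_tree_inj:
  assumes "r \<in> gverts G"
  shows "inj_on (parent_tree (gverts G) r) (rooted_maps G r)"
proof (rule inj_onI)
  let ?V = "gverts G"
  fix f g assume f: "f \<in> rooted_maps G r" and g: "g \<in> rooted_maps G r"
    and eq: "parent_tree ?V r f = parent_tree ?V r g"
  obtain h :: "'a \<Rightarrow> nat" where h: "\<And>x. x \<in> ?V - {r} \<Longrightarrow> h (f x) < h x"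
    and fV: "\<And>x. x \<in> ?V - {r} \<Longrightarrow> f x \<in> ?V"
    using f by (auto simp: rooted_maps_def PiE_iff nbrs_def)
  have "f x = g x" if "x \<in> ?V - {r}" for x
    using that
  proof (induction "h x" arbitrary: x rule: less_induct)
    case less
    show ?case
    proof (rule ccontr)
      assume neq: "f x \<noteq> g x"
      have "adjacent (parent_tree ?V r g) x (f x)"
        using less.prems by (simp add: adjacent_parent_tree flip: eq)
      then have fx: "f x \<in> ?V - {r}" "g (f x) = x"
        using neq by (auto simp: adjacent_parent_tree)
      then have "f (f x) = x" using less.hyps h less.prems by metis
      then show False using h[OF less.prems] h[OF fx(1)] by simp
    qed
  qed
  then show "f = g"
    using f g unfolding rooted_maps_def by (blast intro: PiE_ext)
qed

text \<open>
  Choosing for each vertex of \<open>T\<close> a neighbour closer to \<open>r\<close> gives a parent map whose tree lies in \<open>T\<close>.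
  An edge of \<open>T\<close> outside that tree would close a path in it to a cycle of \<open>T\<close>.
\<close>

lemma parent_tree_surj:
  assumes "r \<in> gverts G" and T: "T \<in> spanning_trees G"
  shows "T \<in> parent_tree (gverts G) r ` rooted_maps G r"
proof -
  let ?V = "gverts G"
  have sT: "simple_graph T" and V: "gverts T = ?V" and sub: "gedges T \<subseteq> gedges G"
    and conn: "\<And>x y. x \<in> ?V \<Longrightarrow> y \<in> ?V \<Longrightarrow> (adjacent T)\<^sup>*\<^sup>* x y"
    and acyc: "\<nexists>vs. is_cycle T vs"
    using T by (auto simp: spanning_trees_def is_subgraph_def is_tree_def connected_graph_def)
  define h where "h x = (LEAST n. (adjacent T ^^ n) x r)" for x
  have h_ex: "\<exists>n. (adjacent T ^^ n) x r" if "x \<in> ?V" for x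
    using conn[OF that assms(1)] by (simp add: rtranclp_power)
  have "\<exists>y. adjacent T x y \<and> h y < h x" if x: "x \<in> ?V - {r}" for x
  proof -
    have *: "(adjacent T ^^ h x) x r"
      unfolding h_def by (rule LeastI_ex) (use h_ex[of x] x in simp)
    moreover have "h x \<noteq> 0"
    proof
      assume "h x = 0"
      with * have "x = r" by simp
      with x show False by simp
    qed
    ultimately obtain m y where m: "h x = Suc m" "adjacent T x y" "(adjacent T ^^ m) y r"
      by (metis not0_implies_Suc relpowp_Suc_D2)
    have "h y \<le> m" unfolding h_def using m(3) by (rule Least_le)
    then show ?thesis using m by auto
  qed
  then obtain p where p: "\<And>x. x \<in> ?V - {r} \<Longrightarrow> adjacent T x (p x) \<and> h (p x) < h x"
    by metis
  define f where "f = restrict p (?V - {r})"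
  have f: "adjacent T x (f x)" "h (f x) < h x" if "x \<in> ?V - {r}" for x
    using p[OF that] that by (auto simp: f_def)
  have "f \<in> rooted_maps G r"
  proof -
    have "f x \<in> nbrs G x" if "x \<in> ?V - {r}" for x
      using f(1)[OF that] simple_graph_adjacentD(2)[OF sT, of x "f x"] sub V
      by (auto simp: nbrs_def adjacent_def)
    then show ?thesis using f(2) by (auto simp: rooted_maps_def f_def)
  qed
  moreover have "T = parent_tree ?V r f"
  proof -
    let ?P = "parent_tree ?V r f"
    have PT: "adjacent T x y" if "adjacent ?P x y" for x y
      using that f(1) by (auto simp: adjacent_parent_tree adjacent_sym)
    have "adjacent ?P x y" if xy: "adjacent T x y" for x y
    proof (rule ccontr)
      assume no: "\<not> adjacent ?P x y"
      have xyV: "x \<in> ?V" "y \<in> ?V" "x \<noteq> y" using simple_graph_adjacentD[OF sT xy] V by auto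
      have "connected_graph ?P"
        using f simple_graph_adjacentD(2)[OF sT] V assms(1)
        by (intro parent_tree_connected[where h = h]) auto
      then have "(adjacent ?P)\<^sup>*\<^sup>* x y"
        using xyV by (simp add: connected_graph_def parent_tree_def)
      then obtain xs where "rtrancl_path (adjacent ?P) x xs y"
        by (auto simp: rtranclp_eq_rtrancl_path)
      then obtain xs where path: "rtrancl_path (adjacent ?P) x xs y" and dist: "distinct (x # xs)"
        by (rule rtrancl_path_distinct)
      have "xs \<noteq> []" using path xyV(3) by (auto elim: rtrancl_path.cases)
      then have last: "last xs = y" using path by (simp add: rtrancl_path_last)
      have step: "adjacent T ((x # xs) ! i) (xs ! i)" if "i < length xs" for i
        using rtrancl_path_nth[OF path that] by (rule PT)
      have "length xs \<noteq> 1"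
        using rtrancl_path_nth[OF path, of 0] last no by (cases xs) auto
      with \<open>xs \<noteq> []\<close> have len: "length xs \<ge> 2"
        by (cases xs; cases "tl xs") auto
      have "is_cycle T (x # xs)"
        unfolding is_cycle_def
      proof (intro conjI allI impI)
        have "xs ! i \<in> gverts T" if "i < length xs" for i
          using step[OF that] by (rule simple_graph_adjacentD(2)[OF sT])
        then show "set (x # xs) \<subseteq> gverts T"
          using xyV(1) V by (auto simp: in_set_conv_nth)
        fix i assume i: "i < length (x # xs)"
        show "adjacent T ((x # xs) ! i) ((x # xs) ! (Suc i mod length (x # xs)))"
        proof (cases "i = length xs")
          case True
          then have "(x # xs) ! i = y"
            using \<open>xs \<noteq> []\<close> last by (simp add: last_conv_nth nth_Cons')
          then show ?thesis using True xy by (simp add: adjacent_sym)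
        next
          case False
          then show ?thesis using step[of i] i by simp
        qed
      qed (use len dist in auto)
      with acyc show False by blast
    qed
    then have adj: "adjacent T x y \<longleftrightarrow> adjacent ?P x y" for x y
      using PT by blast
    have card2: "\<And>e. e \<in> gedges T \<Longrightarrow> card e = 2" "\<And>e. e \<in> gedges ?P \<Longrightarrow> card e = 2"
    proof -
      show "card e = 2" if "e \<in> gedges T" for e
        using that sT by (simp add: simple_graph_def)
      show "card e = 2" if e: "e \<in> gedges ?P" for e
      proof -
        obtain x where x: "x \<in> ?V - {r}" "e = {x, f x}"
          using e by (auto simp: parent_tree_def)
        then have "x \<noteq> f x" using f(2)[of x] by auto
        then show ?thesis using x by simp
      qed
    qed
    have "gedges T = gedges ?P"
    proof (rule equalityI; rule subsetI)
      fix e assume "e \<in> gedges T"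
      then show "e \<in> gedges ?P" using card2(1)[of e] adj by (auto simp: card_2_iff adjacent_def)
    next
      fix e assume "e \<in> gedges ?P"
      then show "e \<in> gedges T" using card2(2)[of e] adj by (auto simp: card_2_iff adjacent_def)
    qed
    then show ?thesis using V by (simp add: parent_tree_def)
  qed
  ultimately show ?thesis by blast
qed

lemma card_rooted_maps:
  assumes "simple_graph G" and "r \<in> gverts G"
  shows "card (rooted_maps G r) = card (spanning_trees G)"
proof -
  have "bij_betw (parent_tree (gverts G) r) (rooted_maps G r) (spanning_trees G)"
    using parent_tree_inj[OF assms(2)] parent_tree_spanning[OF assms]
      parent_tree_surj[OF assms(2)] by (auto simp: bij_betw_def)
  then show ?thesis by (rule bij_betw_same_card)
qed

theorem matrix_tree:
  assumes "finite (gverts G)" and "simple_graph G" and "r \<in> gverts G"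
  shows "set_det (gverts G - {r}) (laplacian G) = real (card (spanning_trees G))"
  using assms by (simp add: set_det_laplacian_minor card_rooted_maps)

lemma laplacian_row_sum:
  assumes "finite (gverts G)" and "simple_graph G" and "x \<in> gverts G"
  shows "(\<Sum>y\<in>gverts G. laplacian G x y) = 0"
proof -
  have "\<not> adjacent G x x"
    using simple_graph_adjacentD(3)[OF assms(2), of x x] by blast
  then have "laplacian G x y =
      (if x = y then real (degree_in G x) else 0) - of_bool (adjacent G x y)" for y
    by (auto simp: laplacian_def)
  then show ?thesis
    using assms(1,3)
    by (simp add: sum_subtractf degree_in_def of_bool_def sum.If_cases Int_def)
qed

text \<open>
  The rows of \<open>L + J\<close> are split into rows of \<open>L\<close> and all-ones rows. With no all-ones row the
  determinant is zero because \<open>L\<close> is singular, with two of them because these are equal. With a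
  single one, in row \<open>r\<close>, it is \<open>card V\<close> times the minor of \<open>L\<close> at \<open>r\<close>: the difference between the
  all-ones row and \<open>card V\<close> times the unit row is annihilated by the all-ones vector, as are the other
  rows. Each of the \<open>card V\<close> choices of \<open>r\<close> thus contributes \<open>card V\<close> times the number of spanning
  trees.
\<close>

lemma set_det_laplacian_plus_ones:
  assumes fin: "finite (gverts G)" and sG: "simple_graph G" and ne: "gverts G \<noteq> {}"
  shows "set_det (gverts G) (\<lambda>x y. laplacian G x y + 1) =
    real (card (gverts G)) ^ 2 * real (card (spanning_trees G))"
proof -
  let ?V = "gverts G"
  let ?L = "laplacian G"
  let ?ones = "\<lambda>_ :: 'a. 1 :: real"
  define D where "D T = set_det ?V (\<lambda>x. if x \<in> T then ?ones else ?L x)" for T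
  have D_empty: "D {} = 0"
    unfolding D_def using ne fin laplacian_row_sum[OF fin sG]
    by (auto intro!: set_det_eq_0_if_kernel[where v = ?ones])
  have D_single: "D {r} = real (card ?V) * real (card (spanning_trees G))" if r: "r \<in> ?V" for r
  proof -
    let ?unit = "\<lambda>y. if r = y then 1 else 0 :: real"
    \<comment> \<open>Row \<open>r\<close> is chosen with entry sum 0, so that the all-ones vector is in the kernel.\<close>
    have "(0::real) = set_det ?V (\<lambda>x. if x = r then (\<lambda>y. 1 + (- real (card ?V)) * ?unit y) else ?L x)"
    proof (rule set_det_eq_0_if_kernel[where v = ?ones and x = r, symmetric])
      fix x assume x: "x \<in> ?V"
      show "(\<Sum>y\<in>?V. (if x = r then (\<lambda>y. 1 + (- real (card ?V)) * ?unit y) else ?L x) y * 1) = 0"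
      proof (cases "x = r")
        case True
        have "(\<Sum>y\<in>?V. 1 + (- real (card ?V)) * ?unit y) = 0"
          using fin r by (simp add: sum_subtractf sum_distrib_left[symmetric])
        then show ?thesis using True by simp
      qed (use laplacian_row_sum[OF fin sG x] in simp)
    qed (use fin r in auto)
    also have "\<dots> = set_det ?V (\<lambda>x. if x = r then ?ones else ?L x)
        + (- real (card ?V)) * set_det ?V (\<lambda>x. if x = r then ?unit else ?L x)"
      by (rule set_det_row_linear[OF fin r])
    also have "set_det ?V (\<lambda>x. if x = r then ?unit else ?L x) =
        set_det ?V (\<lambda>x. if x \<in> ?V - {r} then ?L x else (\<lambda>y. if x = y then 1 else 0))"
      by (rule set_det_cong) auto
    also have "\<dots> = real (card (spanning_trees G))"
      using matrix_tree[OF fin sG r]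
      by (subst set_det_diagonal_rows[OF fin]) auto
    finally show ?thesis by (simp add: D_def)
  qed
  have D_many: "D T = 0" if "T \<subseteq> ?V" "T \<noteq> {}" "\<And>r. T \<noteq> {r}" for T
  proof -
    obtain a b where "a \<in> T" "b \<in> T" "a \<noteq> b" using \<open>T \<noteq> {}\<close> \<open>\<And>r. T \<noteq> {r}\<close> by blast
    then show ?thesis
      unfolding D_def using that(1) fin
      by (intro set_det_identical_rows[of _ a b]) auto
  qed
  have "set_det ?V (\<lambda>x y. ?L x y + 1) = set_det ?V (\<lambda>x y. 1 + ?L x y)"
    by (simp add: add.commute)
  also have "\<dots> = (\<Sum>T\<in>Pow ?V. D T)"
    unfolding D_def by (rule set_det_add[OF fin])
  also have "\<dots> = (\<Sum>T\<in>(\<lambda>r. {r}) ` ?V. D T)"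
    using fin D_empty D_many by (intro sum.mono_neutral_right) blast+
  also have "\<dots> = (\<Sum>r\<in>?V. D {r})"
    by (subst sum.reindex) auto
  also have "\<dots> = real (card ?V) ^ 2 * real (card (spanning_trees G))"
    by (simp add: D_single power2_eq_square)
  finally show ?thesis .
qed

section \<open>Matrices whose entries depend on the classes of their indices\<close>

text \<open>
  Such a \<open>T\<close> is the image of a unique function that picks an element of each fibre of \<open>c\<close> over \<open>S\<close>.
\<close>

lemma card_transversals:
  assumes "finite V" and "finite S"
  shows "card {T. T \<subseteq> V \<and> inj_on c T \<and> c ` T = S} = (\<Prod>d\<in>S. card {x \<in> V. c x = d})"
proof -
  let ?F = "\<lambda>d. {x \<in> V. c x = d}"
  have "bij_betw (\<lambda>f. f ` S) (PiE S ?F) {T. T \<subseteq> V \<and> inj_on c T \<and> c ` T = S}"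
  proof (rule bij_betw_byWitness[where f' = "\<lambda>T. restrict (inv_into T c) S"])
    show "\<forall>f\<in>PiE S ?F. restrict (inv_into (f ` S) c) S = f"
    proof
      fix f assume f: "f \<in> PiE S ?F"
      then have cf: "c (f d) = d" if "d \<in> S" for d using that by (auto simp: PiE_iff)
      then have inj: "inj_on c (f ` S)" by (auto simp: inj_on_def)
      show "restrict (inv_into (f ` S) c) S = f"
      proof
        fix d
        show "restrict (inv_into (f ` S) c) S d = f d"
        proof (cases "d \<in> S")
          case True
          then show ?thesis using inv_into_f_f[OF inj, of "f d"] cf[OF True] by simp
        next
          case False
          then show ?thesis using PiE_arb[OF f] by simp
        qed
      qed
    qed
    show "\<forall>T\<in>{T. T \<subseteq> V \<and> inj_on c T \<and> c ` T = S}. restrict (inv_into T c) S ` S = T"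
      by (auto simp: image_image)
    show "(\<lambda>f. f ` S) ` PiE S ?F \<subseteq> {T. T \<subseteq> V \<and> inj_on c T \<and> c ` T = S}"
      by (force simp: PiE_iff inj_on_def)
    show "(\<lambda>T. restrict (inv_into T c) S) ` {T. T \<subseteq> V \<and> inj_on c T \<and> c ` T = S} \<subseteq> PiE S ?F"
      using inv_into_into f_inv_into_f by (fastforce simp: PiE_iff)
  qed
  then have "card {T. T \<subseteq> V \<and> inj_on c T \<and> c ` T = S} = card (PiE S ?F)"
    by (simp add: bij_betw_same_card)
  also have "\<dots> = (\<Prod>d\<in>S. card (?F d))"
    by (rule card_PiE[OF assms(2)])
  finally show ?thesis .
qed

text \<open>
  In the expansion by principal minors the index sets on which \<open>c\<close> is not injective contribute nothing,
  because their minors have equal rows. The remaining sets \<open>T\<close> are collected by their image \<open>S\<close> under \<open>c\<close>,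
  and all \<open>T\<close> with the same image contribute the same.
\<close>

lemma set_det_blocks:
  fixes B :: "'b \<Rightarrow> 'b \<Rightarrow> 'f::field"
  assumes finV: "finite V" and finW: "finite W" and c: "c ` V \<subseteq> W"
    and m: "\<And>d. d \<in> c ` V \<Longrightarrow> m d \<noteq> 0"
  shows "set_det V (\<lambda>x y. B (c x) (c y) + (if x = y then m (c x) else 0)) =
    (\<Prod>x\<in>V. m (c x)) *
    (\<Sum>S\<in>Pow W. set_det S B * (\<Prod>d\<in>S. of_nat (card {x \<in> V. c x = d}) / m d))"
proof -
  let ?t = "\<lambda>T. set_det T (\<lambda>x y. B (c x) (c y)) * (\<Prod>x\<in>V - T. m (c x))"
  let ?P = "\<Prod>x\<in>V. m (c x)"
  let ?I = "{T. T \<subseteq> V \<and> inj_on c T}"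
  have finI: "finite ?I" using finV by simp
  have non_inj: "?t T = 0" if T: "T \<subseteq> V" "\<not> inj_on c T" for T
  proof -
    obtain x y where "x \<in> T" "y \<in> T" "x \<noteq> y" "c x = c y"
      using T(2) by (auto simp: inj_on_def)
    then show ?thesis
      using finite_subset[OF T(1) finV] by (simp add: set_det_identical_rows[of T x y])
  qed
  have inj: "?t T = ?P * (set_det (c ` T) B * (\<Prod>d\<in>c ` T. 1 / m d))" if T: "T \<in> ?I" for T
  proof -
    have TV: "T \<subseteq> V" and i: "inj_on c T" using T by auto
    have "set_det T (\<lambda>x y. B (c x) (c y)) = set_det (c ` T) B"
      using set_det_reindex[of T c "c ` T" B] finite_subset[OF TV finV] i
      by (simp add: bij_betw_def)
    moreover have "?P = (\<Prod>x\<in>V - T. m (c x)) * (\<Prod>x\<in>T. m (c x))"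
      by (rule prod.subset_diff[OF TV finV])
    moreover have "(\<Prod>x\<in>T. m (c x)) * (\<Prod>x\<in>T. 1 / m (c x)) = 1"
      unfolding prod.distrib[symmetric] using m TV by (intro prod.neutral) auto
    moreover have "(\<Prod>d\<in>c ` T. 1 / m d) = (\<Prod>x\<in>T. 1 / m (c x))"
      using i by (simp add: prod.reindex)
    ultimately show ?thesis by (simp add: mult_ac)
  qed
  have "set_det V (\<lambda>x y. B (c x) (c y) + (if x = y then m (c x) else 0)) = (\<Sum>T\<in>Pow V. ?t T)"
    by (rule set_det_add_diagonal[OF finV])
  also have "\<dots> = (\<Sum>T\<in>?I. ?t T)"
    using finV non_inj by (intro sum.mono_neutral_right) auto
  also have "\<dots> = (\<Sum>T\<in>?I. ?P * (set_det (c ` T) B * (\<Prod>d\<in>c ` T. 1 / m d)))"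
    by (rule sum.cong[OF refl inj])
  also have "\<dots> = (\<Sum>S\<in>Pow W. \<Sum>T\<in>{T \<in> ?I. c ` T = S}.
      ?P * (set_det (c ` T) B * (\<Prod>d\<in>c ` T. 1 / m d)))"
    using finI finW c by (intro sum.group[symmetric]) auto
  also have "\<dots> = (\<Sum>S\<in>Pow W.
      ?P * (set_det S B * (\<Prod>d\<in>S. of_nat (card {x \<in> V. c x = d}) / m d)))"
  proof (rule sum.cong[OF refl])
    fix S assume "S \<in> Pow W"
    then have "finite S" using finW finite_subset by auto
    have "(\<Sum>T\<in>{T \<in> ?I. c ` T = S}. ?P * (set_det (c ` T) B * (\<Prod>d\<in>c ` T. 1 / m d))) =
        of_nat (card {T. T \<subseteq> V \<and> inj_on c T \<and> c ` T = S}) *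
          (?P * (set_det S B * (\<Prod>d\<in>S. 1 / m d)))"
      by (simp add: conj_assoc)
    also have "\<dots> = ?P * (set_det S B * (\<Prod>d\<in>S. of_nat (card {x \<in> V. c x = d}) / m d))"
      unfolding card_transversals[OF finV \<open>finite S\<close>]
      by (simp add: prod_dividef of_nat_prod mult_ac)
    finally show "(\<Sum>T\<in>{T \<in> ?I. c ` T = S}.
        ?P * (set_det (c ` T) B * (\<Prod>d\<in>c ` T. 1 / m d))) =
      ?P * (set_det S B * (\<Prod>d\<in>S. of_nat (card {x \<in> V. c x = d}) / m d))" .
  qed
  finally show ?thesis by (simp add: sum_distrib_left)
qed

section \<open>Orders and cyclic subgroups of the integers modulo n\<close>

lemma dvd_mult_iff_div_gcd_dvd:
  fixes n :: nat
  assumes "n > 0"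
  shows "n dvd k * a \<longleftrightarrow> n div gcd a n dvd k"
proof -
  obtain a' n' where a: "a = a' * gcd a n" and n: "n = n' * gcd a n" and "coprime a' n'"
    using gcd_coprime_exists[of a n] assms by auto
  have g: "gcd a n \<noteq> 0" using assms by simp
  have "n dvd k * a \<longleftrightarrow> n' * gcd a n dvd (k * a') * gcd a n"
    using a n by (metis mult.assoc)
  also have "\<dots> \<longleftrightarrow> n' dvd k * a'" using g by simp
  also have "\<dots> \<longleftrightarrow> n' dvd k"
    using \<open>coprime a' n'\<close> by (simp add: coprime_dvd_mult_left_iff coprime_commute)
  also have "n' = n div gcd a n" using n g by (metis nonzero_mult_div_cancel_right)
  finally show ?thesis .
qed

lemma div_dvd_div_iff_dvd:
  fixes n :: nat
  assumes "n > 0" "a dvd n" "b dvd n"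
  shows "n div a dvd n div b \<longleftrightarrow> b dvd a"
proof -
  obtain a' where na: "n = a * a'" using assms(2) by (elim dvdE)
  obtain b' where nb: "n = b * b'" using assms(3) by (elim dvdE)
  note n = na nb
  have pos: "a > 0" "a' > 0" "b > 0" using n \<open>n > 0\<close> by (auto intro: gr0I)
  have "n div a = a'" "n div b = b'" using n pos by (metis nonzero_mult_div_cancel_left less_irrefl)+
  moreover have "a' dvd b'" if "b dvd a"
  proof -
    obtain t where "a = b * t" using \<open>b dvd a\<close> by (auto elim: dvdE)
    then have "b * (t * a') = b * b'" using n by (metis mult.assoc)
    then show ?thesis using pos by (metis dvd_triv_right mult_cancel1 less_irrefl)
  qed
  moreover have "b dvd a" if "a' dvd b'"
  proof -
    obtain t where "b' = a' * t" using \<open>a' dvd b'\<close> by (auto elim: dvdE)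
    then have "(b * t) * a' = a * a'" using n by (metis mult.assoc mult.commute)
    then show ?thesis using pos by (metis dvd_triv_left mult_cancel2 less_irrefl)
  qed
  ultimately show ?thesis by metis
qed

lemma ord_integer_mod_group:
  assumes "n > 0" and x: "x \<in> carrier (integer_mod_group n)"
  shows "group.ord (integer_mod_group n) x = n div gcd (nat x) n"
proof -
  interpret group "integer_mod_group n" by (rule group_integer_mod_group)
  have x0: "x = int (nat x)" using x \<open>n > 0\<close> by (simp add: carrier_integer_mod_group)
  have "x [^]\<^bsub>integer_mod_group n\<^esub> k = \<one>\<^bsub>integer_mod_group n\<^esub> \<longleftrightarrow>
      n div gcd (nat x) n dvd k" for k :: nat
  proof -
    have "int k * x mod int n = 0 \<longleftrightarrow> int n dvd int (k * nat x)"
      using x0 by (simp add: dvd_eq_mod_eq_0)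
    also have "\<dots> \<longleftrightarrow> n div gcd (nat x) n dvd k"
      unfolding int_dvd_int_iff by (rule dvd_mult_iff_div_gcd_dvd[OF \<open>n > 0\<close>])
    finally show ?thesis by simp
  qed
  then show ?thesis using ord_unique[OF x] by blast
qed

lemma ord_integer_mod_group_dvd:
  assumes "n > 0" and "x \<in> carrier (integer_mod_group n)"
  shows "group.ord (integer_mod_group n) x dvd n"
  unfolding ord_integer_mod_group[OF assms] by (metis dvd_def dvd_div_mult_self gcd_dvd2)

text \<open>
  The residues generated by \<open>y\<close> are the multiples of \<open>gcd y n\<close>, by Bezout's identity.
\<close>

lemma generate_subset_iff_gcd_dvd:
  assumes "n > 0" and x: "x \<in> carrier (integer_mod_group n)"
    and y: "y \<in> carrier (integer_mod_group n)"
  shows "generate (integer_mod_group n) {x} \<subseteq> generate (integer_mod_group n) {y} \<longleftrightarrow>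
    gcd y (int n) dvd x"
proof -
  interpret group "integer_mod_group n" by (rule group_integer_mod_group)
  have gen: "generate (integer_mod_group n) {z} = {k * z mod int n | k. True}"
    if "z \<in> carrier (integer_mod_group n)" for z
    using generate_pow[OF that] by (simp add: int_pow_integer_mod_group)
  show ?thesis
  proof
    assume sub: "generate (integer_mod_group n) {x} \<subseteq> generate (integer_mod_group n) {y}"
    have "x \<in> generate (integer_mod_group n) {x}" by (rule generate.incl) simp
    with sub obtain k where "x = k * y mod int n" using gen[OF y] by auto
    then show "gcd y (int n) dvd x" by (simp add: dvd_mod)
  next
    assume "gcd y (int n) dvd x"
    then obtain t where t: "x = gcd y (int n) * t" by (auto elim: dvdE)
    obtain u v where "u * y + v * int n = gcd y (int n)" using bezout_int by blast
    then have x_eq: "x = (t * u) * y + (t * v) * int n"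
      using t by (metis distrib_left mult.assoc mult.commute)
    have "j * x mod int n = (j * t * u) * y mod int n" for j
    proof -
      have "j * x = (j * t * u) * y + (j * t * v) * int n"
        unfolding x_eq by (simp add: algebra_simps)
      then show ?thesis by simp
    qed
    then show "generate (integer_mod_group n) {x} \<subseteq> generate (integer_mod_group n) {y}"
      unfolding gen[OF x] gen[OF y] by blast
  qed
qed

lemma generate_subset_iff_ord_dvd:
  assumes "n > 0" and x: "x \<in> carrier (integer_mod_group n)"
    and y: "y \<in> carrier (integer_mod_group n)"
  shows "generate (integer_mod_group n) {x} \<subseteq> generate (integer_mod_group n) {y} \<longleftrightarrow>
    group.ord (integer_mod_group n) x dvd group.ord (integer_mod_group n) y"
proof -
  have eq: "x = int (nat x)" "y = int (nat y)"
    using x y \<open>n > 0\<close> by (simp_all add: carrier_integer_mod_group)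
  have "gcd y (int n) dvd x \<longleftrightarrow> int (gcd (nat y) n) dvd int (nat x)"
    using eq by (metis gcd_int_int_eq)
  also have "\<dots> \<longleftrightarrow> gcd (nat y) n dvd gcd (nat x) n"
    unfolding int_dvd_int_iff by simp
  also have "\<dots> \<longleftrightarrow> n div gcd (nat x) n dvd n div gcd (nat y) n"
    using \<open>n > 0\<close> by (subst div_dvd_div_iff_dvd) auto
  finally show ?thesis
    using assms by (simp add: generate_subset_iff_gcd_dvd ord_integer_mod_group)
qed

text \<open>
  The residue \<open>x\<close> has order \<open>e\<close> iff \<open>gcd x n = n div e\<close>. The totient counts the
  representatives with this property in \<open>{0<..n}\<close>; passing to \<open>{0..<n}\<close> exchanges \<open>n\<close> and \<open>0\<close>.
\<close>

lemma card_ord_integer_mod_group: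
  assumes "n > 0" and "e dvd n"
  shows "card {x \<in> carrier (integer_mod_group n). group.ord (integer_mod_group n) x = e} = totient e"
proof -
  let ?A = "{k \<in> {0<..n}. gcd k n = n div e}"
  let ?B = "{x \<in> carrier (integer_mod_group n). group.ord (integer_mod_group n) x = e}"
  have e: "n div g = e \<longleftrightarrow> g = n div e" if "g dvd n" for g
    using that assms by (metis dvd_div_eq_0_iff div_div_eq_right dvd_div_eq_mult mult.commute
        nonzero_mult_div_cancel_right not_gr0 dvd_mult_div_cancel dvd_0_left_iff)
  have carrier: "x \<in> carrier (integer_mod_group n) \<longleftrightarrow> 0 \<le> x \<and> x < int n" for x
    using \<open>n > 0\<close> by (auto simp: carrier_integer_mod_group)
  have B: "x \<in> ?B \<longleftrightarrow> 0 \<le> x \<and> x < int n \<and> gcd (nat x) n = n div e" for x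
    using e[of "gcd (nat x) n"] ord_integer_mod_group[OF \<open>n > 0\<close>, of x] by (auto simp: carrier)
  have "bij_betw (\<lambda>k. int (k mod n)) ?A ?B"
  proof (rule bij_betw_byWitness[where f' = "\<lambda>x. if x = 0 then n else nat x"])
    show "\<forall>k\<in>?A. (if int (k mod n) = 0 then n else nat (int (k mod n))) = k"
      by (auto simp: le_less dest: dvd_imp_le)
    show "\<forall>x\<in>?B. int ((if x = 0 then n else nat x) mod n) = x"
      unfolding Ball_def B by auto
    show "(\<lambda>k. int (k mod n)) ` ?A \<subseteq> ?B"
      unfolding image_subset_iff Ball_def B using \<open>n > 0\<close> by auto
    show "(\<lambda>x. if x = 0 then n else nat x) ` ?B \<subseteq> ?A"
      unfolding image_subset_iff Ball_def B using \<open>n > 0\<close> by auto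
  qed
  then have "card ?B = card ?A" by (simp add: bij_betw_same_card)
  also have "\<dots> = totient (n div (n div e))"
    using assms by (intro card_gcd_eq_totient) auto
  also have "n div (n div e) = e"
    using assms by (metis div_div_eq_right dvd_refl div_self mult_1 less_irrefl)
  finally show ?thesis .
qed

section \<open>The Laplacian of the power graph\<close>

lemma adjacent_graph_of:
  "adjacent (graph_of V R) x y \<longleftrightarrow> x \<in> V \<and> y \<in> V \<and> x \<noteq> y \<and> (R x y \<or> R y x)"
  by (auto simp: adjacent_def graph_of_def doubleton_eq_iff)

lemma simple_graph_of: "simple_graph (graph_of V R)"
  by (auto simp: simple_graph_def graph_of_def)

text \<open>
  For a divisor \<open>e\<close> of \<open>n\<close> this is the number \<open>m\<close> in the formula: the size of the closed neighbourhood,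
  in the power graph, of an element of order \<open>e\<close>.
\<close>

definition comparable_count :: "nat \<Rightarrow> nat \<Rightarrow> nat" where
  "comparable_count n e = card {y \<in> carrier (integer_mod_group n).
     e dvd group.ord (integer_mod_group n) y \<or> group.ord (integer_mod_group n) y dvd e}"

definition incomparable :: "nat \<Rightarrow> nat \<Rightarrow> real" where
  "incomparable e e' = of_bool (\<not> (e dvd e' \<or> e' dvd e))"

lemma adjacent_power_graph:
  assumes "n > 0" and "x \<in> carrier (integer_mod_group n)" "y \<in> carrier (integer_mod_group n)"
  shows "adjacent (power_graph (integer_mod_group n)) x y \<longleftrightarrow> x \<noteq> y \<and>
    (group.ord (integer_mod_group n) x dvd group.ord (integer_mod_group n) y \<or>
     group.ord (integer_mod_group n) y dvd group.ord (integer_mod_group n) x)"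
  using assms generate_subset_iff_ord_dvd[OF assms] generate_subset_iff_ord_dvd[OF assms(1,3,2)]
  unfolding power_graph_def adjacent_graph_of by auto

lemma finite_carrier_integer_mod_group: "n > 0 \<Longrightarrow> finite (carrier (integer_mod_group n))"
  by (simp add: carrier_integer_mod_group)

lemma degree_power_graph:
  assumes "n > 0" and x: "x \<in> carrier (integer_mod_group n)"
  shows "degree_in (power_graph (integer_mod_group n)) x + 1 =
    comparable_count n (group.ord (integer_mod_group n) x)"
proof -
  let ?o = "group.ord (integer_mod_group n)"
  let ?C = "{y \<in> carrier (integer_mod_group n). ?o x dvd ?o y \<or> ?o y dvd ?o x}"
  have "{y \<in> carrier (integer_mod_group n). adjacent (power_graph (integer_mod_group n)) x y} =
      ?C - {x}"
    using adjacent_power_graph[OF assms] by auto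
  then have "degree_in (power_graph (integer_mod_group n)) x = card (?C - {x})"
    by (simp add: degree_in_def power_graph_def graph_of_def)
  moreover have "finite ?C" "x \<in> ?C"
    using finite_carrier_integer_mod_group[OF \<open>n > 0\<close>] x by simp_all
  then have "card (?C - {x}) + 1 = card ?C"
    using card_Suc_Diff1[of ?C x] by simp
  ultimately show ?thesis
    by (simp only: comparable_count_def)
qed

text \<open>
  The neutral element has order 1, which divides everything.
\<close>

lemma comparable_count_pos:
  assumes "n > 0"
  shows "comparable_count n e > 0"
proof -
  have "group.ord (integer_mod_group n) 0 = 1"
    using assms by (simp add: ord_integer_mod_group)
  then have "0 \<in> {y \<in> carrier (integer_mod_group n).
      e dvd group.ord (integer_mod_group n) y \<or> group.ord (integer_mod_group n) y dvd e}"
    by simp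
  then show ?thesis
    unfolding comparable_count_def card_gt_0_iff
    using finite_carrier_integer_mod_group[OF assms] by fastforce
qed

text \<open>
  Each set \<open>S\<close> contributes \<open>1 / \<lambda>\<close> for its own members; multiplying by \<open>\<Phi>\<close> turns this into a factor
  \<open>\<lambda>\<close> for each divisor outside \<open>S\<close>, which is the form with the exponents \<open>t\<close>.
\<close>

theorem kappa_integer_mod_group:
  assumes "n > 0"
  shows "real n ^ 2 * real (kappa (integer_mod_group n)) =
    (\<Prod>e | e dvd n. real (comparable_count n e) ^ totient e) *
    (\<Sum>S\<in>Pow ({e. e dvd n} - {n, 1}).
       set_det S incomparable * (\<Prod>e\<in>S. real (totient e) / real (comparable_count n e)))"
proof -
  let ?G = "power_graph (integer_mod_group n)"
  let ?V = "carrier (integer_mod_group n)"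
  let ?o = "group.ord (integer_mod_group n)"
  let ?D = "{e. e dvd n}"
  let ?M = "\<lambda>e. real (comparable_count n e)"
  let ?w = "\<lambda>S c. set_det S incomparable * (\<Prod>e\<in>S. real (c e) / ?M e)"
  have verts: "gverts ?G = ?V" by (simp add: power_graph_def graph_of_def)
  have sG: "simple_graph ?G" unfolding power_graph_def by (rule simple_graph_of)
  have finV: "finite ?V" by (rule finite_carrier_integer_mod_group[OF assms])
  have neV: "?V \<noteq> {}" using integer_mod_group_0 by blast
  have cardV: "card ?V = n" using assms by (simp add: carrier_integer_mod_group)
  have finD: "finite ?D" using assms by simp
  have oD: "?o ` ?V \<subseteq> ?D" using ord_integer_mod_group_dvd[OF assms] by auto
  have "real n ^ 2 * real (kappa (integer_mod_group n)) =
      set_det ?V (\<lambda>x y. laplacian ?G x y + 1)"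
    using set_det_laplacian_plus_ones[of ?G] finV neV sG by (simp add: verts cardV kappa_def)
  also have "\<dots> = set_det ?V
      (\<lambda>x y. incomparable (?o x) (?o y) + (if x = y then ?M (?o x) else 0))"
  proof (rule set_det_cong[OF refl])
    fix x y assume xy: "x \<in> ?V" "y \<in> ?V"
    show "laplacian ?G x y + 1 =
        incomparable (?o x) (?o y) + (if x = y then ?M (?o x) else 0)"
      using degree_power_graph[OF assms xy(1)] adjacent_power_graph[OF assms xy]
      by (auto simp: laplacian_def incomparable_def)
  qed
  also have "\<dots> = (\<Prod>x\<in>?V. ?M (?o x)) *
      (\<Sum>S\<in>Pow ?D. ?w S (\<lambda>e. card {x \<in> ?V. ?o x = e}))"
    using comparable_count_pos[OF assms]
    by (intro set_det_blocks[OF finV finD oD]) (simp add: less_imp_neq[symmetric])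
  also have "(\<Prod>x\<in>?V. ?M (?o x)) = (\<Prod>e\<in>?D. \<Prod>x\<in>{x \<in> ?V. ?o x = e}. ?M (?o x))"
    by (rule prod.group[OF finV finD oD, symmetric])
  also have "\<dots> = (\<Prod>e\<in>?D. ?M e ^ totient e)"
    by (intro prod.cong refl) (simp add: card_ord_integer_mod_group[OF assms])
  also have "(\<Sum>S\<in>Pow ?D. ?w S (\<lambda>e. card {x \<in> ?V. ?o x = e})) = (\<Sum>S\<in>Pow ?D. ?w S totient)"
    by (intro sum.cong refl arg_cong2[where f = "(*)"] prod.cong)
       (auto simp: card_ord_integer_mod_group[OF assms])
  also have "(\<Sum>S\<in>Pow ?D. ?w S totient) = (\<Sum>S\<in>Pow (?D - {n, 1}). ?w S totient)"
  proof (rule sum.mono_neutral_right)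
    show "\<forall>S\<in>Pow ?D - Pow (?D - {n, 1}). ?w S totient = 0"
    proof
      fix S assume S: "S \<in> Pow ?D - Pow (?D - {n, 1})"
      then obtain e where e: "e \<in> S" "e = n \<or> e = 1" by auto
      have "finite S" using S finD by (auto intro: finite_subset)
      moreover have "incomparable e e' = 0" if "e' \<in> S" for e'
        using that e(2) S by (auto simp: incomparable_def)
      ultimately have "set_det S incomparable = 0"
        using set_det_eq_0_if_zero_row[of S e] e(1) by blast
      then show "?w S totient = 0" by simp
    qed
  qed (use finD in auto)
  finally show ?thesis .
qed

section \<open>Induced subgraphs and principal minors\<close>

definition induced :: "'a ugraph \<Rightarrow> 'a set \<Rightarrow> 'a ugraph" where
  "induced H S = \<lparr>gverts = S, gedges = {e \<in> gedges H. e \<subseteq> S}\<rparr>"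

lemma is_induced_subgraph_iff:
  assumes "simple_graph H"
  shows "is_induced_subgraph \<Lambda> H \<longleftrightarrow> (\<exists>S \<subseteq> gverts H. \<Lambda> = induced H S)"
proof
  assume "is_induced_subgraph \<Lambda> H"
  then show "\<exists>S \<subseteq> gverts H. \<Lambda> = induced H S"
    by (intro exI[of _ "gverts \<Lambda>"])
       (auto simp: is_induced_subgraph_def is_subgraph_def induced_def)
next
  assume "\<exists>S \<subseteq> gverts H. \<Lambda> = induced H S"
  then show "is_induced_subgraph \<Lambda> H"
    using assms
    by (auto simp: is_induced_subgraph_def is_subgraph_def induced_def simple_graph_def)
qed

lemma det_adjacency_matrix:
  assumes "finite (gverts G)"
  shows "det (adjacency_matrix G) = set_det (gverts G) (\<lambda>x y. of_bool (adjacent G x y))"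
  using set_det_eq_det[of "sorted_list_of_set (gverts G)" "\<lambda>x y. of_bool (adjacent G x y) :: real"]
    assms by (simp add: adjacency_matrix_def Let_def of_bool_def)

text \<open>
  An induced subgraph is determined by its vertex set, so the sum over induced subgraphs is a sum over
  sets of vertices.
\<close>

lemma sum_induced_subgraphs:
  fixes H :: "'a::linorder ugraph"
  assumes "finite (gverts H)" and "simple_graph H"
  shows "(\<Sum>\<Lambda> | is_induced_subgraph \<Lambda> H \<and> gverts \<Lambda> \<noteq> {}.
      det (adjacency_matrix \<Lambda>) * g (gverts \<Lambda>)) =
    (\<Sum>S\<in>Pow (gverts H) - {{}}. set_det S (\<lambda>x y. of_bool (adjacent H x y)) * g S)"
proof (rule sum.reindex_bij_witness[where i = "induced H" and j = gverts], goal_cases)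
  case (5 \<Lambda>)
  then obtain S where S: "S \<subseteq> gverts H" "\<Lambda> = induced H S"
    using is_induced_subgraph_iff[OF assms(2)] by blast
  then have "adjacent \<Lambda> x y = adjacent H x y" if "x \<in> S" "y \<in> S" for x y
    using that by (simp add: adjacent_def induced_def)
  then have "det (adjacency_matrix \<Lambda>) = set_det S (\<lambda>x y. of_bool (adjacent H x y))"
    using S finite_subset[OF S(1) assms(1)]
    by (subst det_adjacency_matrix) (auto simp: induced_def intro!: set_det_cong)
  then show ?case using S by (simp add: induced_def)
qed (auto simp: is_induced_subgraph_iff[OF assms(2)] induced_def)

lemma adjacent_incomparability_graph:
  assumes "e dvd n" "e' dvd n" "e \<notin> X" "e' \<notin> X"
  shows "adjacent (delete_vertices (complement_graph (divisor_graph n)) X) e e' \<longleftrightarrow>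
    \<not> (e dvd e' \<or> e' dvd e)"
proof -
  have "adjacent (delete_vertices H X) e e' \<longleftrightarrow> adjacent H e e'" for H
    using assms(3,4) by (auto simp: adjacent_def delete_vertices_def)
  then show ?thesis
    using assms(1,2)
    by (auto simp: complement_graph_def divisor_graph_def adjacent_graph_of)
       (auto simp: graph_of_def)
qed

theorem theorem4p1:
  fixes n k :: nat
    and d deg m :: "nat \<Rightarrow> nat"
    and lam :: "nat \<Rightarrow> real"
    and Phi :: real
  assumes n_pos: "n > 0"
    and d_divisors: "d ` {1..k} = {e. e dvd n}"
    and d_decreasing: "\<And>i j. 1 \<le> i \<Longrightarrow> i < j \<Longrightarrow> j \<le> k \<Longrightarrow> d j < d i"
    and deg: "\<And>i. i \<in> {1..k} \<Longrightarrow>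
      \<exists>x\<in>carrier (integer_mod_group n).
        group.ord (integer_mod_group n) x = d i \<and>
        deg i = degree_in (power_graph (integer_mod_group n)) x"
    and m: "\<And>i. i \<in> {1..k} \<Longrightarrow> m i = deg i + 1"
    and lam: "\<And>i. i \<in> {2..k-1} \<Longrightarrow> lam i = real (m i) / real (totient (d i))"
    and Phi: "Phi = (\<Prod>i\<in>{2..k-1}. lam i)"
  shows "(\<forall>i\<in>{1..k}. \<forall>x\<in>carrier (integer_mod_group n).
            group.ord (integer_mod_group n) x = d i \<longrightarrow>
            degree_in (power_graph (integer_mod_group n)) x = deg i)
    \<and> real (kappa (integer_mod_group n)) =
        1 / (Phi * real n ^ 2) * (\<Prod>i\<in>{1..k}. real (m i) ^ totient (d i)) *
        (Phi + (\<Sum>\<Lambda> | is_induced_subgraph \<Lambda>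
                           (delete_vertices (complement_graph (divisor_graph n)) {d 1, d k})
                         \<and> gverts \<Lambda> \<noteq> {}.
                  det (adjacency_matrix \<Lambda>) *
                  (\<Prod>i\<in>{2..k-1}. lam i ^ (if d i \<in> gverts \<Lambda> then 0 else 1))))"
proof -
  let ?M = "\<lambda>e. real (comparable_count n e)"
  have m_eq: "m i = comparable_count n (d i)" if i: "i \<in> {1..k}" for i
    using deg[OF i] m[OF i] degree_power_graph[OF n_pos] by force
  let ?D = "{e. e dvd n}"
  let ?E = "?D - {n, 1}"
  let ?H = "delete_vertices (complement_graph (divisor_graph n)) {d 1, d k}"
  define l where "l e = ?M e / real (totient e)" for e
  have mono: "d j \<le> d i" if "i \<in> {1..k}" "j \<in> {1..k}" "i \<le> j" for i j
    using d_decreasing[of i j] that by (cases "i = j") auto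
  have inj: "inj_on d {1..k}"
    using d_decreasing by (intro linorder_inj_onI) (force simp: Ball_def)+
  have "k \<ge> 1" using d_divisors n_pos by (cases k) auto
  have d1: "d 1 = n"
  proof -
    obtain i where "i \<in> {1..k}" "d i = n" using d_divisors by (metis (mono_tags) dvd_refl imageE mem_Collect_eq)
    then have "n \<le> d 1" using mono[of 1 i] by auto
    moreover have "d 1 dvd n" using d_divisors \<open>k \<ge> 1\<close> by auto
    ultimately show ?thesis using dvd_imp_le n_pos le_antisym by blast
  qed
  have dk: "d k = 1"
  proof -
    obtain i where "i \<in> {1..k}" "d i = 1" using d_divisors by (metis (mono_tags) one_dvd imageE mem_Collect_eq)
    then have "d k \<le> 1" using mono[of i k] by auto
    moreover have "d k dvd n" using d_divisors \<open>k \<ge> 1\<close> by auto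
    ultimately show ?thesis using n_pos by (cases "d k") auto
  qed
  have bij: "bij_betw d {2..k-1} ?E"
  proof -
    have "{1..k} - {1, k} = {2..k-1}" by auto
    moreover have "d ` ({1..k} - {1, k}) = ?D - {n, 1}"
      using inj_on_image_set_diff[OF inj, of "{1..k}" "{1, k}"] \<open>k \<ge> 1\<close> d1 dk d_divisors by simp
    ultimately show ?thesis
      using inj_on_subset[OF inj, of "{2..k-1}"] by (auto simp: bij_betw_def)
  qed
  have lam_eq: "lam i = l (d i)" if "i \<in> {2..k-1}" for i
  proof -
    have "i \<in> {1..k}" using that by auto
    then show ?thesis using lam[OF that] m_eq[of i] by (simp add: l_def)
  qed
  have tot_pos: "totient e > 0" if "e dvd n" for e
    using that n_pos by (auto intro: Nat.gr0I)
  have l_nz: "l e \<noteq> 0" if "e \<in> ?E" for e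
    using that comparable_count_pos[OF n_pos, of e] tot_pos[of e] by (auto simp: l_def)
  have finE: "finite ?E" using n_pos by simp
  have Phi_eq: "Phi = (\<Prod>e\<in>?E. l e)"
    unfolding Phi using prod.reindex_bij_betw[OF bij, of l] lam_eq by simp
  have "Phi \<noteq> 0" unfolding Phi_eq using l_nz finE by simp
  \<comment> \<open>The exponents select the \<open>\<lambda>\<close> of the divisors outside \<open>S\<close>; dividing \<open>\<Phi>\<close> by those in \<open>S\<close> has the same effect.\<close>
  have complement: "(\<Prod>i\<in>{2..k-1}. lam i ^ (if d i \<in> S then 0 else 1)) =
      Phi * (\<Prod>e\<in>S. real (totient e) / ?M e)" if S: "S \<subseteq> ?E" for S
  proof -
    have "(\<Prod>i\<in>{2..k-1}. lam i ^ (if d i \<in> S then 0 else 1)) =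
        (\<Prod>e\<in>?E. l e ^ (if e \<in> S then 0 else 1))"
      using prod.reindex_bij_betw[OF bij, of "\<lambda>e. l e ^ (if e \<in> S then 0 else 1)"] lam_eq
      by simp
    also have "\<dots> = (\<Prod>e\<in>?E - S. l e)"
      by (subst prod.subset_diff[OF S finE]) simp
    also have "\<dots> = (\<Prod>e\<in>?E - S. l e) * (\<Prod>e\<in>S. l e * (real (totient e) / ?M e))"
    proof -
      have "l e * (real (totient e) / ?M e) = 1" if "e \<in> S" for e
        using l_nz[of e] S that by (auto simp: l_def)
      then have "(\<Prod>e\<in>S. l e * (real (totient e) / ?M e)) = 1"
        by (intro prod.neutral ballI)
      then show ?thesis by (simp only: mult_1_right)
    qed
    also have "\<dots> = Phi * (\<Prod>e\<in>S. real (totient e) / ?M e)"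
      unfolding Phi_eq prod.subset_diff[OF S finE, of l] prod.distrib by (simp only: mult.assoc)
    finally show ?thesis .
  qed
  let ?w = "\<lambda>S. set_det S incomparable * (Phi * (\<Prod>e\<in>S. real (totient e) / ?M e))"
  have verts: "gverts ?H = ?E"
    unfolding d1 dk
    by (simp add: delete_vertices_def complement_graph_def divisor_graph_def graph_of_def)
  have simple: "simple_graph ?H"
    using simple_graph_of[of "gverts (divisor_graph n)" "\<lambda>x y. \<not> adjacent (divisor_graph n) x y"]
    by (auto simp: simple_graph_def delete_vertices_def complement_graph_def)
  have "(\<Sum>\<Lambda> | is_induced_subgraph \<Lambda> ?H \<and> gverts \<Lambda> \<noteq> {}. det (adjacency_matrix \<Lambda>) *
          (\<Prod>i\<in>{2..k-1}. lam i ^ (if d i \<in> gverts \<Lambda> then 0 else 1))) =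
      (\<Sum>S\<in>Pow ?E - {{}}. set_det S (\<lambda>x y. of_bool (adjacent ?H x y)) *
          (\<Prod>i\<in>{2..k-1}. lam i ^ (if d i \<in> S then 0 else 1)))"
    using sum_induced_subgraphs[OF _ simple,
        of "\<lambda>S. \<Prod>i\<in>{2..k-1}. lam i ^ (if d i \<in> S then 0 else 1)"] finE
    unfolding verts by blast
  also have "\<dots> = (\<Sum>S\<in>Pow ?E - {{}}. ?w S)"
  proof (intro sum.cong refl arg_cong2[where f = "(*)"])
    fix S assume "S \<in> Pow ?E - {{}}"
    then have S: "S \<subseteq> ?E" by blast
    show "set_det S (\<lambda>x y. of_bool (adjacent ?H x y)) = set_det S incomparable"
    proof (rule set_det_cong[OF refl])
      fix e e' assume "e \<in> S" "e' \<in> S"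
      then show "of_bool (adjacent ?H e e') = incomparable e e'"
        using S unfolding d1 dk
        by (subst adjacent_incomparability_graph) (auto simp: incomparable_def)
    qed
    show "(\<Prod>i\<in>{2..k-1}. lam i ^ (if d i \<in> S then 0 else 1)) =
        Phi * (\<Prod>e\<in>S. real (totient e) / ?M e)"
      by (rule complement[OF S])
  qed
  also have "Phi + \<dots> = (\<Sum>S\<in>Pow ?E. ?w S)"
    using sum.remove[of "Pow ?E" "{}" ?w] finE by (simp add: set_det_def)
  also have "\<dots> = Phi * (\<Sum>S\<in>Pow ?E. set_det S incomparable *
      (\<Prod>e\<in>S. real (totient e) / ?M e))"
    by (simp add: sum_distrib_left mult_ac)
  finally have bracket: "Phi + (\<Sum>\<Lambda> | is_induced_subgraph \<Lambda> ?H \<and> gverts \<Lambda> \<noteq> {}.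
        det (adjacency_matrix \<Lambda>) *
        (\<Prod>i\<in>{2..k-1}. lam i ^ (if d i \<in> gverts \<Lambda> then 0 else 1))) =
      Phi * (\<Sum>S\<in>Pow ?E. set_det S incomparable * (\<Prod>e\<in>S. real (totient e) / ?M e))" .
  have prods: "(\<Prod>i\<in>{1..k}. real (m i) ^ totient (d i)) = (\<Prod>e\<in>?D. ?M e ^ totient e)"
    using prod.reindex[OF inj, of "\<lambda>e. ?M e ^ totient e"] m_eq d_divisors by simp
  show ?thesis
  proof (intro conjI ballI impI)
    fix i x assume "i \<in> {1..k}" "x \<in> carrier (integer_mod_group n)"
      and "group.ord (integer_mod_group n) x = d i"
    then show "degree_in (power_graph (integer_mod_group n)) x = deg i"
      using m_eq[of i] m[of i] degree_power_graph[OF n_pos, of x] by simp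
  next
    show "real (kappa (integer_mod_group n)) =
        1 / (Phi * real n ^ 2) * (\<Prod>i\<in>{1..k}. real (m i) ^ totient (d i)) *
        (Phi + (\<Sum>\<Lambda> | is_induced_subgraph \<Lambda> ?H \<and> gverts \<Lambda> \<noteq> {}.
                  det (adjacency_matrix \<Lambda>) *
                  (\<Prod>i\<in>{2..k-1}. lam i ^ (if d i \<in> gverts \<Lambda> then 0 else 1))))"
      unfolding bracket prods using kappa_integer_mod_group[OF n_pos] \<open>Phi \<noteq> 0\<close> n_pos
      by (simp add: field_simps)
  qed
qed

end
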